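(* Kimberling's infinite word ${\bf B}$ is equal to $0f({\bf TR})$, where ${\bf TR}$ is the infinite Tribonacci word and $f$ is the morphism $f: 0\mapsto 10,\ 1\mapsto 0,\ 2\mapsto 1$. (Here $0f({\bf TR})$ is the letter $0$ followed by the infinite word $f({\bf TR})$.)
   Context: Definition of ${\bf B}$: Let $B_0=00$. Given a binary word $B_i$, factor it into blocks: each letter $1$ is a block by itself, and each maximal run of consecutive $0$'s is a block, which is either $0$ or $00$ (runs of three or more $0$'s never occur). Then $B_{i+1}$ is obtained by replacing each block $0$ by $0$, each block $1$ by $10$, and each block $00$ by $0101$. For example $B_1=0101$, $B_2=010010$, $B_3=0100101100$. For $i\ge 2$, $B_i$ is a prefix of $B_{i+1}$, and ${\bf B}=0100101100\cdots$ is the unique infinite word having all $B_i$, $i\ge 2$, as prefixes. The Tribonacci word ${\bf TR}=0102010010201\cdots$ is the infinite fixed point (starting with $0$) of the morphism $0\mapsto 01$, $1\mapsto 02$, $2\mapsto 0$. *)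

theory Defs
  imports Main "HOL-Library.Stream"
begin

text \<open>Letters are natural numbers, finite words are lists, infinite words are streams.\<close>

function blocks :: "nat list \<Rightarrow> nat list list" where
  "blocks [] = []"
| "blocks (a # w) =
     (if a = 0
      then (a # takeWhile (\<lambda>x. x = 0) w) # blocks (dropWhile (\<lambda>x. x = 0) w)
      else [a] # blocks w)"
  by pat_completeness auto
termination
  by (relation "measure length") (auto simp: le_imp_less_Suc length_dropWhile_le)

text \<open>The last branch (in particular a run of three or more zeros) does not arise for the words
  \<open>kimb_word i\<close> below.\<close>

definition block_image :: "nat list \<Rightarrow> nat list" where
  "block_image b =
     (if b = [0] then [0]
      else if b = [1] then [1, 0]
      else if b = [0, 0] then [0, 1, 0, 1]
      else undefined)"

primrec kimb_word :: "nat \<Rightarrow> nat list" where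
  "kimb_word 0 = [0, 0]"
| "kimb_word (Suc i) = concat (map block_image (blocks (kimb_word i)))"

lemma kimb_word_examples:
  "kimb_word 1 = [0, 1, 0, 1]"
  "kimb_word 2 = [0, 1, 0, 0, 1, 0]"
  "kimb_word 3 = [0, 1, 0, 0, 1, 0, 1, 1, 0, 0]"
  by (simp_all add: eval_nat_numeral block_image_def)

definition is_prefix :: "'a list \<Rightarrow> 'a stream \<Rightarrow> bool" where
  "is_prefix u w \<longleftrightarrow> stake (length u) w = u"

definition kimberling :: "nat stream" where
  "kimberling = (THE w. \<forall>i\<ge>2. is_prefix (kimb_word i) w)"

text \<open>The extension of a morphism to infinite words.  The function \<open>flat\<close> is concatenation only
  when every list in its argument is nonempty, so this is to be used with nonerasing morphisms.\<close>

definition morph_stream :: "('a \<Rightarrow> 'b list) \<Rightarrow> 'a stream \<Rightarrow> 'b stream" where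
  "morph_stream h w = flat (smap h w)"

text \<open>The next two morphisms have domain alphabet \<open>{0, 1, 2}\<close>.\<close>

definition trib_morph :: "nat \<Rightarrow> nat list" where
  "trib_morph a =
     (if a = 0 then [0, 1] else if a = 1 then [0, 2] else if a = 2 then [0] else undefined)"

definition f_morph :: "nat \<Rightarrow> nat list" where
  "f_morph a =
     (if a = 0 then [1, 0] else if a = 1 then [0] else if a = 2 then [1] else undefined)"

definition tribonacci :: "nat stream" where
  "tribonacci = (THE w. sset w \<subseteq> {0, 1, 2} \<and> shd w = 0 \<and> morph_stream trib_morph w = w)"

end

theory Submission
  imports Defs
begin

text \<open>
  Write \<open>\<theta>\<close> for the Tribonacci morphism.  The words \<open>f (\<theta> a)\<close> for \<open>a = 0, 1, 2\<close> are
  \<open>100\<close>, \<open>101\<close>, \<open>10\<close>; each begins with \<open>1\<close>, so the block factorisation of \<open>f (\<theta> w)\<close> is the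
  concatenation of the factorisations of these words.  Replacing the blocks gives \<open>100101\<close>,
  \<open>10010\<close>, \<open>100\<close>, which are exactly the words \<open>f (\<theta> (\<theta> a))\<close>.  Hence
  \<open>B\<^sub>i = 0 f (\<theta>\<^sup>i 1)\<close> for \<open>i \<ge> 1\<close>, and \<open>\<theta>\<^sup>i 1\<close> is a prefix of the Tribonacci word for \<open>i \<ge> 2\<close>
  because \<open>\<theta> (\<theta> 1) = 010\<close> is one.
\<close>

section \<open>Prefixes of streams\<close>

lemma is_prefix_iff: "is_prefix u w \<longleftrightarrow> (\<exists>s. w = u @- s)"
proof
  assume "is_prefix u w"
  then have "w = u @- sdrop (length u) w"
    unfolding is_prefix_def by (metis stake_sdrop)
  then show "\<exists>s. w = u @- s" ..
qed (auto simp: is_prefix_def stake_shift)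

lemma is_prefix_appendD: "is_prefix (u @ v) w \<Longrightarrow> is_prefix u w"
  by (auto simp: is_prefix_iff)

lemma is_prefix_Cons_SCons: "is_prefix (a # u) (a ## w) \<longleftrightarrow> is_prefix u w"
  by (simp add: is_prefix_def)

lemma is_prefix_snth: "is_prefix u w \<Longrightarrow> k < length u \<Longrightarrow> w !! k = u ! k"
  by (auto simp: is_prefix_iff)

lemma is_prefixI_snth: "(\<And>k. k < length u \<Longrightarrow> w !! k = u ! k) \<Longrightarrow> is_prefix u w"
  unfolding is_prefix_def by (rule nth_equalityI) (auto simp: stake_nth)

lemma stream_eq_if_common_prefixes:
  assumes "\<And>n. is_prefix (u n) w" "\<And>n. is_prefix (u n) w'" "\<And>n. n < length (u n)"
  shows "w = w'"
proof -
  have "w !! n = w' !! n" for n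
    using assms is_prefix_snth by metis
  \<comment> \<open>\<open>smap_alt\<close> characterises an \<open>smap\<close> letter by letter,
    hence the detour through \<open>id\<close>.\<close>
  then have "smap id w = w'"
    unfolding smap_alt by simp
  then show ?thesis
    by (simp add: stream.map_id)
qed

lemma prefix_chain_limit:
  assumes chain: "\<And>n. \<exists>v. u (Suc n) = u n @ v"
    and long: "\<And>n. n < length (u n)"
  shows "\<exists>w. \<forall>n. is_prefix (u n) w"
proof -
  have later: "\<exists>v. u n = u m @ v" if "m \<le> n" for m n
    using that
  proof (induction rule: dec_induct)
    case (step n)
    then show ?case using chain[of n] by auto
  qed simp
  \<comment> \<open>The limit is read off the diagonal: \<open>u k\<close> is long enough to have
    position \<open>k\<close>, and all words of the chain that reach this position agree
    there.\<close>
  have "u k ! k = u n ! k" if "k < length (u n)" for k n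
  proof (cases "k \<le> n")
    case True
    then show ?thesis using later[of k n] long[of k] by (auto simp: nth_append)
  next
    case False
    then show ?thesis using later[of n k] that by (auto simp: nth_append)
  qed
  then have "is_prefix (u n) (smap (\<lambda>k. u k ! k) nats)" for n
    by (intro is_prefixI_snth) simp
  then show ?thesis by blast
qed

section \<open>Morphisms\<close>

abbreviation morph_word :: "('a \<Rightarrow> 'b list) \<Rightarrow> 'a list \<Rightarrow> 'b list" where
  "morph_word h u \<equiv> concat (map h u)"

lemma length_morph_word_ge:
  assumes "\<And>a. a \<in> set u \<Longrightarrow> h a \<noteq> []"
  shows "length u \<le> length (morph_word h u)"
  using assms
proof (induction u)
  case (Cons a u)
  then have "length u \<le> length (morph_word h u)" "h a \<noteq> []"
    by auto
  then show ?case by (cases "h a") simp_all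
qed simp

lemma morph_stream_shift:
  assumes "\<And>a. a \<in> set u \<Longrightarrow> h a \<noteq> []"
  shows "morph_stream h (u @- s) = morph_word h u @- morph_stream h s"
  using assms by (induction u) (simp_all add: morph_stream_def)

lemma is_prefix_morph_stream:
  assumes "is_prefix u w" "\<And>a. a \<in> set u \<Longrightarrow> h a \<noteq> []"
  shows "is_prefix (morph_word h u) (morph_stream h w)"
  using assms morph_stream_shift by (metis is_prefix_iff)

lemma morph_word_funpow_append:
  fixes h :: "'a \<Rightarrow> 'a list"
  shows "(morph_word h ^^ n) (u @ v) = (morph_word h ^^ n) u @ (morph_word h ^^ n) v"
  by (induction n arbitrary: u v) simp_all

section \<open>The Tribonacci word\<close>

text \<open>\<open>Suc 0\<close> is the form into which the simplifier brings the letter 1.\<close>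

lemma trib_morph_simps [simp]:
  "trib_morph 0 = [0, 1]" "trib_morph (Suc 0) = [0, 2]" "trib_morph 2 = [0]"
  by (simp_all add: trib_morph_def)

lemma f_morph_simps [simp]:
  "f_morph 0 = [1, 0]" "f_morph (Suc 0) = [0]" "f_morph 2 = [1]"
  by (simp_all add: f_morph_def)

lemma trib_morph_nonempty: "a \<in> {0, 1, 2} \<Longrightarrow> trib_morph a \<noteq> []"
  by auto

lemma f_morph_nonempty: "a \<in> {0, 1, 2} \<Longrightarrow> f_morph a \<noteq> []"
  by auto

abbreviation trib_iterate :: "nat \<Rightarrow> nat list \<Rightarrow> nat list" where
  "trib_iterate n \<equiv> morph_word trib_morph ^^ n"

lemma set_trib_iterate:
  assumes "set u \<subseteq> {0, 1, 2}"
  shows "set (trib_iterate n u) \<subseteq> {0, 1, 2}"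
proof (induction n)
  case (Suc n)
  then show ?case by fastforce
qed (use assms in simp)

lemma length_trib_iterate_ge:
  assumes "set u \<subseteq> {0, 1, 2}"
  shows "length u \<le> length (trib_iterate n u)"
proof (induction n)
  case (Suc n)
  have "length (trib_iterate n u) \<le> length (trib_iterate (Suc n) u)"
    using length_morph_word_ge[of "trib_iterate n u" trib_morph]
      trib_morph_nonempty set_trib_iterate[OF assms] by auto
  with Suc show ?case by linarith
qed simp

text \<open>Peeling off the innermost application, with \<theta> 0 = 01, shows that the iterates of
  0 form a prefix chain.\<close>

lemma trib_iterate_Suc_0: "trib_iterate (Suc n) [0] = trib_iterate n [0] @ trib_iterate n [1]"
  using morph_word_funpow_append[of n trib_morph "[0]" "[1]"]
  by (simp add: funpow_Suc_right del: funpow.simps)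

lemma less_length_trib_iterate: "n < length (trib_iterate n [0])"
proof (induction n)
  case (Suc n)
  then show ?case
    unfolding trib_iterate_Suc_0
    using length_trib_iterate_ge[of "[1]" n] by simp
qed simp

text \<open>\<theta> maps a prefix of a fixed point to a prefix of the same fixed point.\<close>

lemma is_prefix_trib_iterate:
  assumes "shd w = 0" "morph_stream trib_morph w = w"
  shows "is_prefix (trib_iterate n [0]) w"
proof (induction n)
  case 0
  then show ?case using assms(1) by (simp add: is_prefix_def)
next
  case (Suc n)
  have "is_prefix (trib_iterate (Suc n) [0]) (morph_stream trib_morph w)"
    using is_prefix_morph_stream[OF Suc, of trib_morph]
      trib_morph_nonempty set_trib_iterate[of "[0]" n] by auto
  then show ?case using assms(2) by simp
qed

text \<open>Justifies the definite description in \<open>tribonacci\<close>: the limit of the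
  iterates of 0 is one solution, and every solution has all these iterates as prefixes.\<close>

lemma tribonacci_unique:
  "\<exists>!w. sset w \<subseteq> {0, 1, 2} \<and> shd w = 0 \<and> morph_stream trib_morph w = w"
proof (rule ex_ex1I)
  obtain w where w: "is_prefix (trib_iterate n [0]) w" for n
    using prefix_chain_limit[of "\<lambda>n. trib_iterate n [0]"]
      trib_iterate_Suc_0 less_length_trib_iterate by blast
  have "w !! n \<in> {0, 1, 2}" for n
    using is_prefix_snth[OF w less_length_trib_iterate, of n]
      set_trib_iterate[of "[0]" n] nth_mem[OF less_length_trib_iterate, of n] by auto
  then have "sset w \<subseteq> {0, 1, 2}"
    unfolding sset_range by (rule image_subsetI)
  moreover have "shd w = 0"
    using is_prefix_snth[OF w, of 0 0] by simp
  moreover have "morph_stream trib_morph w = w"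
  \<comment> \<open>Applying \<theta> to the n-th iterate gives the next one, so the comparison uses
    the iterates shifted by one.\<close>
  proof (rule stream_eq_if_common_prefixes[where u = "\<lambda>n. trib_iterate (Suc n) [0]"])
    show "is_prefix (trib_iterate (Suc n) [0]) (morph_stream trib_morph w)" for n
      using is_prefix_morph_stream[OF w, of n trib_morph]
        trib_morph_nonempty set_trib_iterate[of "[0]" n] by auto
    show "n < length (trib_iterate (Suc n) [0])" for n
      using less_length_trib_iterate[of "Suc n"] by (rule Suc_lessD)
  qed (rule w)
  ultimately show "\<exists>w. sset w \<subseteq> {0, 1, 2} \<and> shd w = 0 \<and> morph_stream trib_morph w = w"
    by blast
next
  fix w w'
  assume "sset w \<subseteq> {0, 1, 2} \<and> shd w = 0 \<and> morph_stream trib_morph w = w"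
    and "sset w' \<subseteq> {0, 1, 2} \<and> shd w' = 0 \<and> morph_stream trib_morph w' = w'"
  then show "w = w'"
    using stream_eq_if_common_prefixes[of "\<lambda>n. trib_iterate n [0]" w w']
      is_prefix_trib_iterate less_length_trib_iterate by blast
qed

lemma is_prefix_tribonacci: "is_prefix (trib_iterate n [0]) tribonacci"
  using theI'[OF tribonacci_unique] is_prefix_trib_iterate
  unfolding tribonacci_def by blast

text \<open>Splitting \<theta> (\<theta> 1) = 010 after its first letter transfers the length bound
  for the iterates of 0 to those of 1.\<close>

lemma trib_iterate_1_eq: "trib_iterate (n + 2) [1] = trib_iterate n [0] @ trib_iterate n [1, 0]"
proof -
  have "trib_iterate (n + 2) [1] = trib_iterate n ([0] @ [1, 0])"
    by (simp add: funpow_Suc_right del: funpow.simps)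
  then show ?thesis by (simp only: morph_word_funpow_append)
qed

lemma is_prefix_tribonacci_1: "is_prefix (trib_iterate (n + 2) [1]) tribonacci"
proof (rule is_prefix_appendD)
  \<comment> \<open>\<theta> (\<theta> 0) = 0102 is \<theta> (\<theta> 1) = 010 followed by
    2.\<close>
  have "trib_iterate (n + 2) [0] = trib_iterate n ([0, 1, 0] @ [2])"
    "trib_iterate (n + 2) [1] = trib_iterate n [0, 1, 0]"
    by (simp_all add: funpow_Suc_right del: funpow.simps)
  then have "trib_iterate (n + 2) [0] = trib_iterate (n + 2) [1] @ trib_iterate n [2]"
    by (simp only: morph_word_funpow_append)
  then show "is_prefix (trib_iterate (n + 2) [1] @ trib_iterate n [2]) tribonacci"
    using is_prefix_tribonacci[of "n + 2"] by simp
qed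

section \<open>The Kimberling words\<close>

text \<open>Each f (\<theta> a) begins with 1, so a run of zeros standing before such a word ends
  where the word starts.\<close>

lemma takeWhile_dropWhile_f_trib:
  assumes "set w \<subseteq> {0, 1, 2}"
  defines "v \<equiv> morph_word f_morph (morph_word trib_morph w)"
  shows "takeWhile (\<lambda>x. x = 0) v = []" "dropWhile (\<lambda>x. x = 0) v = v"
  using assms by (cases w; auto)+

lemma block_image_f_trib:
  assumes "set w \<subseteq> {0, 1, 2}"
  shows "morph_word block_image (blocks (morph_word f_morph (morph_word trib_morph w))) =
    morph_word f_morph (morph_word trib_morph (morph_word trib_morph w))"
  using assms
proof (induction w)
  case (Cons a w)
  then have "a = 0 \<or> a = Suc 0 \<or> a = 2" by auto
  \<comment> \<open>For the letters 0 and 2 the word f (\<theta> a) ends in zeros; that run is a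
    complete block, as what follows does not begin with 0.\<close>
  with Cons takeWhile_dropWhile_f_trib[of w] show ?case
    by (auto simp: block_image_def)
qed simp

text \<open>Index 0 fits the formula too, but there f 1 = 0 merges with the leading 0 into the block
  00, so the induction starts at index 1.\<close>

lemma kimb_word_eq: "kimb_word (Suc n) = 0 # morph_word f_morph (trib_iterate (Suc n) [1])"
proof (induction n)
  case 0
  show ?case by (simp add: block_image_def)
next
  case (Suc n)
  let ?u = "trib_iterate n [1]"
  have u: "set ?u \<subseteq> {0, 1, 2}"
    by (rule set_trib_iterate) simp
  have "kimb_word (Suc (Suc n)) =
    morph_word block_image (blocks (0 # morph_word f_morph (morph_word trib_morph ?u)))"
    using Suc by simp
  \<comment> \<open>The leading 0 is a block of its own here, and \<open>block_image\<close> fixes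
    it.\<close>
  also have "\<dots> = 0 # morph_word block_image (blocks (morph_word f_morph (morph_word trib_morph ?u)))"
    using takeWhile_dropWhile_f_trib[OF u] by (simp add: block_image_def)
  also have "\<dots> = 0 # morph_word f_morph (trib_iterate (Suc (Suc n)) [1])"
    unfolding block_image_f_trib[OF u] by simp
  finally show ?case .
qed

lemma less_length_kimb_word: "n < length (kimb_word (n + 2))"
proof -
  have "length (trib_iterate (n + 2) [1]) \<le> length (morph_word f_morph (trib_iterate (n + 2) [1]))"
    using f_morph_nonempty set_trib_iterate[of "[1]" "n + 2"]
    by (intro length_morph_word_ge) auto
  moreover have "n < length (trib_iterate (n + 2) [1])"
    unfolding trib_iterate_1_eq using less_length_trib_iterate[of n] by simp
  ultimately show ?thesis
    using kimb_word_eq[of "n + 1"] by simp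
qed

theorem theorem2: "kimberling = 0 ## morph_stream f_morph tribonacci"
  unfolding kimberling_def
proof (rule the_equality)
  show prefixes: "\<forall>i\<ge>2. is_prefix (kimb_word i) (0 ## morph_stream f_morph tribonacci)"
  proof (intro allI impI)
    fix i :: nat
    assume "2 \<le> i"
    \<comment> \<open>The bound 2 matters: \<theta> 1 = 02 is not a prefix of the Tribonacci
      word.\<close>
    then obtain n where i: "i = n + 2"
      by (metis le_add_diff_inverse2)
    have "is_prefix (morph_word f_morph (trib_iterate (n + 2) [1])) (morph_stream f_morph tribonacci)"
      using f_morph_nonempty set_trib_iterate[of "[1]" "n + 2"]
      by (intro is_prefix_morph_stream is_prefix_tribonacci_1) auto
    moreover have "kimb_word i = 0 # morph_word f_morph (trib_iterate (n + 2) [1])"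
      using kimb_word_eq[of "n + 1"] i by simp
    ultimately show "is_prefix (kimb_word i) (0 ## morph_stream f_morph tribonacci)"
      by (simp only: is_prefix_Cons_SCons)
  qed
  fix w
  assume "\<forall>i\<ge>2. is_prefix (kimb_word i) w"
  with prefixes show "w = 0 ## morph_stream f_morph tribonacci"
    \<comment> \<open>Starting the sequence at index 2 keeps it within the assumption, and its
      lengths grow enough to determine every letter of \<open>w\<close>.\<close>
    by (intro stream_eq_if_common_prefixes[where u = "\<lambda>n. kimb_word (n + 2)"] less_length_kimb_word)
      (simp_all del: kimb_word.simps)
qed

end
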